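(* Let $n\ge3$ be odd. Every self-dual code $C$ in $\mathbb{F}_2^{n+1}$ has a basis $\{\mathbf{y}_1,\ldots,\mathbf{y}_{(n+1)/2}\}$ with $\mathbf{y}_1+\cdots+\mathbf{y}_{(n+1)/2}=\mathbf{j}_{n+1}$.
   Context: A linear code $C\subseteq\mathbb{F}_2^{N}$ is self-dual if $C=C^\perp$ with respect to the standard dot product. $\mathbf{j}_{n+1}$ is the all-ones vector in $\mathbb{F}_2^{n+1}$. *)

theory Defs
  imports "HOL-Analysis.Analysis" "HOL-Library.Z2"
begin

text \<open>Vectors of F_2^N are modelled as bit ^ 'n with CARD('n) = N; the
  field F_2 is the type bit of HOL-Library.Z2.  The standard dot product:\<close>

definition dotF2 :: "bit ^ 'n \<Rightarrow> bit ^ 'n \<Rightarrow> bit" where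
  "dotF2 x y = (\<Sum>i\<in>UNIV. x $ i * y $ i)"

definition dual_code :: "(bit ^ 'n) set \<Rightarrow> (bit ^ 'n) set" where
  "dual_code C = {x. \<forall>y\<in>C. dotF2 x y = 0}"

text \<open>A linear code is a subspace; it is self-dual if it equals its dual.\<close>

definition linear_code :: "(bit ^ 'n) set \<Rightarrow> bool" where
  "linear_code C \<longleftrightarrow> vec.subspace C"

definition self_dual :: "(bit ^ 'n) set \<Rightarrow> bool" where
  "self_dual C \<longleftrightarrow> linear_code C \<and> C = dual_code C"

definition all_ones :: "bit ^ 'n" where
  "all_ones = (\<chi> i. 1)"

end

(* Over F_2 one has <x, x> = <x, j>, so every codeword of a self-dual code C is orthogonal to j,
   i.e. j lies in C; and dim C = (n + 1) / 2 because dim W + dim W^perp = n + 1 for every subspace W.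
   Extend j = b_1 to a basis b_1, ..., b_k of C and replace b_1 by b_1 + ... + b_k: this is again a
   basis, and its sum is b_1 + 2 (b_2 + ... + b_k) = j. *)
theory Submission
  imports Defs
begin

(* Z2 declares simp rules that turn bit arithmetic into xor/and, and sums over bit into
   cardinalities; we want ordinary ring reasoning instead. *)
declare add_bit_eq_xor [simp del] mult_bit_eq_and [simp del]

lemma dotF2_commute: "dotF2 x y = dotF2 y x"
  unfolding dotF2_def by (simp add: mult.commute)

lemma dotF2_add_left: "dotF2 (a + b) x = dotF2 a x + dotF2 b x"
  unfolding dotF2_def by (simp add: distrib_right sum.distrib)

lemma dotF2_smult_left: "dotF2 (c *s a) x = c * dotF2 a x"
  unfolding dotF2_def by (simp add: sum_distrib_left mult.assoc)

lemma dotF2_axis_right: "dotF2 x (axis j 1) = x $ j"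
  unfolding dotF2_def axis_def by (simp add: if_distrib cong: if_cong)

lemma dotF2_zero_left: "dotF2 0 x = 0"
  unfolding dotF2_def by simp

lemma dotF2_self_all_ones: "dotF2 x x = dotF2 x all_ones"
proof -
  have idem: "(a::bit) * a = a" for a by (cases a) simp_all
  show ?thesis unfolding dotF2_def all_ones_def by (simp only: idem vec_lambda_beta mult_1_right)
qed

lemma dual_code_span: "dual_code (vec.span S) = dual_code S"
proof
  show "dual_code (vec.span S) \<subseteq> dual_code S"
    unfolding dual_code_def using vec.span_base by blast
next
  show "dual_code S \<subseteq> dual_code (vec.span S)"
  proof
    fix x assume x: "x \<in> dual_code S"
    have "vec.subspace {y. dotF2 y x = 0}"
      unfolding vec.subspace_def by (simp add: dotF2_add_left dotF2_smult_left dotF2_zero_left)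
    moreover have "S \<subseteq> {y. dotF2 y x = 0}"
      using x unfolding dual_code_def by (auto simp: dotF2_commute)
    ultimately have "vec.span S \<subseteq> {y. dotF2 y x = 0}"
      by (rule vec.span_minimal[rotated])
    then show "x \<in> dual_code (vec.span S)"
      unfolding dual_code_def by (auto simp: dotF2_commute)
  qed
qed

lemma dual_code_UNIV: "dual_code UNIV = {0}"
proof -
  have "x = 0" if "x \<in> dual_code UNIV" for x
  proof -
    have "dotF2 x (axis j 1) = 0" for j
      using that unfolding dual_code_def by blast
    then have "x $ j = 0" for j by (simp only: dotF2_axis_right)
    then show ?thesis by (simp add: vec_eq_iff)
  qed
  then show ?thesis by (auto simp: dual_code_def dotF2_commute[of _ 0] dotF2_zero_left)
qed

lemma dim_coordinate_subspace:
  "vec.dim {v :: 'a::field ^ 'n. \<forall>i\<in>U. v $ i = 0} = CARD('n) - card U"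
proof -
  define Z :: "('a ^ 'n) set" where "Z = {v. \<forall>i\<in>U. v $ i = 0}"
  define E where "E = (\<lambda>i. axis i (1::'a)) ` (- U)"
  have "E \<subseteq> Z" unfolding E_def Z_def by (auto simp: axis_def)
  moreover have "Z \<subseteq> vec.span E"
  proof
    fix v assume "v \<in> Z"
    then have "v $ i *s axis i 1 \<in> vec.span E" for i
      unfolding Z_def E_def by (cases "i \<in> U") (auto intro: vec.span_scale vec.span_base vec.span_zero)
    then have "(\<Sum>i\<in>UNIV. v $ i *s axis i 1) \<in> vec.span E" by (rule vec.span_sum)
    then show "v \<in> vec.span E" by (simp only: basis_expansion)
  qed
  moreover have "vec.independent E"
    by (rule vec.independent_mono[OF independent_cart_basis]) (auto simp: E_def cart_basis_def)
  ultimately have "vec.dim Z = card E" by (simp add: vec.basis_card_eq_dim)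
  also have "\<dots> = card (- U)"
    unfolding E_def by (rule card_image) (auto simp: inj_on_def axis_eq_axis)
  also have "\<dots> = CARD('n) - card U"
    by (simp add: card_Diff_subset Compl_eq_Diff_UNIV)
  finally show ?thesis unfolding Z_def .
qed

lemma dim_coordinate_preimage:
  fixes A :: "'a::field ^ 'n ^ 'n"
  assumes inj: "inj ((*v) A)"
  shows "vec.dim {x. \<forall>i\<in>U. (A *v x) $ i = 0} = CARD('n) - card U"
proof -
  define P where "P = {x. \<forall>i\<in>U. (A *v x) $ i = 0}"
  have lin: "Vector_Spaces.linear (*s) (*s) ((*v) A)" by (rule matrix_vector_mul_linear_gen)
  have "surj ((*v) A)" using vec.linear_inj_imp_surj[OF lin inj] .
  then have "(*v) A ` P = {v. \<forall>i\<in>U. v $ i = 0}"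
  proof (intro equalityI subsetI)
    fix v :: "'a ^ 'n" assume "v \<in> {v. \<forall>i\<in>U. v $ i = 0}"
    moreover obtain x where "v = A *v x" using \<open>surj ((*v) A)\<close> by (metis surjD)
    ultimately show "v \<in> (*v) A ` P" unfolding P_def by blast
  qed (auto simp: P_def)
  moreover have "vec.dim ((*v) A ` P) = vec.dim P"
    by (rule vec.dim_image_eq[OF lin inj_on_subset[OF inj subset_UNIV]])
  ultimately show ?thesis unfolding P_def by (simp add: dim_coordinate_subspace)
qed

lemma dim_dual_code_independent:
  fixes B :: "(bit ^ 'n) set"
  assumes "vec.independent B"
  shows "vec.dim (dual_code B) = CARD('n) - card B"
proof -
  obtain B' where B': "B \<subseteq> B'" "vec.independent B'" "UNIV \<subseteq> vec.span B'"
    by (rule vec.maximal_independent_subset_extend[OF subset_UNIV assms]) blast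
  have "finite B'" using B'(2) vec.finiteI_independent by blast
  moreover have "card B' = CARD('n)"
    using vec.basis_card_eq_dim[of B' UNIV] B' vec_dim_card by auto
  ultimately obtain e :: "'n \<Rightarrow> bit ^ 'n" where e: "bij_betw e UNIV B'"
    using finite_same_card_bij[of "UNIV :: 'n set" B'] by auto
  (* The rows of A are a basis of the whole space extending B, so A is invertible and maps
     dual_code B onto a coordinate subspace. *)
  define A :: "bit ^ 'n ^ 'n" where "A = (\<chi> i. e i)"
  have Av: "(A *v x) $ i = dotF2 x (e i)" for x i
    unfolding A_def matrix_vector_mult_def dotF2_def by (simp add: mult.commute)
  have "x = 0" if "A *v x = 0" for x
  proof -
    have "x \<in> dual_code B'"
      using that e unfolding dual_code_def bij_betw_def by (auto simp: vec_eq_iff simp flip: Av)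
    then have "x \<in> dual_code UNIV"
      using B'(3) dual_code_span[of B'] by (simp add: top.extremum_unique)
    then show "x = 0" by (simp add: dual_code_UNIV)
  qed
  then have inj: "inj ((*v) A)" by (simp add: vec.inj_on_iff_eq_0[OF vec.subspace_UNIV])
  define U where "U = e -` B"
  have eU: "e ` U = B" using B'(1) e unfolding U_def bij_betw_def by auto
  have "card B = card U"
    unfolding eU[symmetric] by (rule card_image[OF inj_on_subset[OF bij_betw_imp_inj_on[OF e] subset_UNIV]])
  moreover have "dual_code B = {x. \<forall>i\<in>U. (A *v x) $ i = 0}"
    using eU unfolding dual_code_def Av by auto
  ultimately show ?thesis using dim_coordinate_preimage[OF inj] by simp
qed

lemma dim_dual_code:
  fixes W :: "(bit ^ 'n) set"
  assumes "vec.subspace W"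
  shows "vec.dim W + vec.dim (dual_code W) = CARD('n)"
proof -
  obtain B where B: "B \<subseteq> W" "vec.independent B" "W \<subseteq> vec.span B" "card B = vec.dim W"
    using vec.basis_exists[of W] by blast
  have "vec.span B = W" using vec.span_subspace[OF B(1,3) assms] .
  then have "dual_code W = dual_code B" using dual_code_span by metis
  then show ?thesis
    using dim_dual_code_independent[OF B(2)] B(4) dim_subset_UNIV_cart_gen[of W] by simp
qed

lemma dim_self_dual:
  fixes C :: "(bit ^ 'n) set"
  assumes "self_dual C"
  shows "2 * vec.dim C = CARD('n)"
  using assms dim_dual_code[of C] unfolding self_dual_def linear_code_def by simp

lemma all_ones_mem_self_dual:
  assumes "self_dual C"
  shows "all_ones \<in> C"
proof -
  have C: "C = dual_code C" using assms by (simp add: self_dual_def)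
  have "dotF2 all_ones c = 0" if "c \<in> C" for c
  proof -
    have "dotF2 c c = 0" using that C unfolding dual_code_def by blast
    moreover have "dotF2 all_ones c = dotF2 c c"
      by (simp only: dotF2_commute[of all_ones c] dotF2_self_all_ones[of c])
    ultimately show ?thesis by simp
  qed
  then have "all_ones \<in> dual_code C" unfolding dual_code_def by blast
  with C show ?thesis by simp
qed

lemma bit_vec_add_self: "(v :: bit ^ 'n) + v = 0"
proof -
  have add_self: "(a :: bit) + a = 0" for a by (cases a) simp_all
  show ?thesis unfolding vec_eq_iff by (simp add: add_self)
qed

lemma spanning_family_card_eq_imp_basis:
  fixes y :: "'i \<Rightarrow> 'a::field ^ 'n"
  assumes I: "finite I" and B: "vec.independent B"
    and span: "vec.span (y ` I) = vec.span B" and card: "card I = card B"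
  shows "inj_on y I \<and> vec.independent (y ` I)"
proof -
  have dim: "vec.dim (vec.span B) = card I" using B card by (simp add: vec.dim_eq_card_independent)
  have sub: "y ` I \<subseteq> vec.span B" using vec.span_superset[of "y ` I"] unfolding span .
  have spans: "vec.span B \<subseteq> vec.span (y ` I)" using span by simp
  have "card I \<le> card (y ` I)"
    using vec.span_card_ge_dim[OF sub spans finite_imageI[OF I]] dim by simp
  then have "card (y ` I) = card I" using card_image_le[OF I, of y] by linarith
  then show ?thesis
    using eq_card_imp_inj_on[OF I] vec.card_le_dim_spanning[OF sub spans finite_imageI[OF I]] dim
    by simp
qed

lemma exists_enumerated_basis_sum_eq:
  fixes B :: "(bit ^ 'n) set"
  assumes indep: "vec.independent B" and j: "j \<in> B"
  shows "\<exists>y. inj_on y {1..card B} \<and> vec.independent (y ` {1..card B})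
           \<and> vec.span (y ` {1..card B}) = vec.span B \<and> (\<Sum>i = 1..card B. y i) = j"
proof -
  define I where "I = {1..card B}"
  have "finite B" using indep vec.finiteI_independent by blast
  then obtain b where b: "bij_betw b I B" unfolding I_def using ex_bij_betw_nat_finite_1 by blast
  then have bI: "b ` I = B" by (simp add: bij_betw_def)
  then obtain t where t: "t \<in> I" "b t = j" using j by blast
  define s where "s = (\<Sum>i\<in>I - {t}. b i)"
  define y where "y = b(t := j + s)"
  have y_other: "y i = b i" if "i \<noteq> t" for i using that by (simp add: y_def)
  have sum_y: "(\<Sum>i\<in>I. y i) = j"
  proof -
    have "(\<Sum>i\<in>I. y i) = y t + (\<Sum>i\<in>I - {t}. y i)"
      using t(1) by (simp add: sum.remove I_def)
    also have "(\<Sum>i\<in>I - {t}. y i) = s" unfolding s_def by (rule sum.cong) (auto simp: y_other)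
    finally show ?thesis by (simp add: y_def add.assoc bit_vec_add_self)
  qed
  have "y ` I \<subseteq> vec.span B"
  proof
    fix v assume "v \<in> y ` I"
    then obtain i where i: "i \<in> I" "v = y i" by blast
    have "s \<in> vec.span B" unfolding s_def using bI by (intro vec.span_sum vec.span_base) blast
    then have "y t \<in> vec.span B" using j by (simp add: y_def vec.span_add vec.span_base)
    then show "v \<in> vec.span B" using i bI y_other by (cases "i = t") (auto intro: vec.span_base)
  qed
  moreover have "B \<subseteq> vec.span (y ` I)"
  proof
    fix v assume "v \<in> B"
    then obtain i where i: "i \<in> I" "v = b i" using bI by blast
    have "j \<in> vec.span (y ` I)" unfolding sum_y[symmetric] by (intro vec.span_sum vec.span_base) blast
    moreover have "b i \<in> vec.span (y ` I)" if "i \<noteq> t"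
      using i(1) y_other[OF that] by (metis imageI vec.span_base)
    ultimately show "v \<in> vec.span (y ` I)" using i t by (cases "i = t") auto
  qed
  ultimately have span_y: "vec.span (y ` I) = vec.span B" by (simp only: vec.span_eq)
  have "inj_on y I \<and> vec.independent (y ` I)"
    using spanning_family_card_eq_imp_basis[OF _ indep span_y] by (simp add: I_def)
  then show ?thesis using span_y sum_y unfolding I_def by blast
qed

theorem lemma8p9:
  fixes n :: nat and C :: "(bit ^ 'n) set"
  assumes "odd n" and "n \<ge> 3" and "CARD('n) = n + 1"
    and "self_dual C"
  shows "\<exists>y :: nat \<Rightarrow> bit ^ 'n.
           inj_on y {1..(n + 1) div 2}
         \<and> vec.independent (y ` {1..(n + 1) div 2})
         \<and> vec.span (y ` {1..(n + 1) div 2}) = C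
         \<and> (\<Sum>i = 1..(n + 1) div 2. y i) = all_ones"
proof -
  have sub: "vec.subspace C" using assms(4) unfolding self_dual_def linear_code_def by blast
  have "all_ones \<noteq> (0 :: bit ^ 'n)" by (simp add: all_ones_def vec_eq_iff)
  then have "vec.independent {all_ones :: bit ^ 'n}" by (simp add: vec.independent_insert)
  moreover have "{all_ones} \<subseteq> C" using all_ones_mem_self_dual[OF assms(4)] by simp
  ultimately obtain B where B: "{all_ones} \<subseteq> B" "B \<subseteq> C" "vec.independent B" "C \<subseteq> vec.span B"
    using vec.maximal_independent_subset_extend by metis
  have "vec.span B = C" using vec.span_subspace[OF B(2,4) sub] .
  moreover have "card B = (n + 1) div 2"
    using vec.basis_card_eq_dim[OF B(2,4,3)] dim_self_dual[OF assms(4)] assms(3) by simp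
  moreover have "all_ones \<in> B" using B(1) by simp
  ultimately show ?thesis using exists_enumerated_basis_sum_eq[OF B(3)] by metis
qed

end
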